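(* Consider the linear system $\frac{dx}{dt}=A(t)x$, $t\in[t_0,T]$, with set of initial conditions the ball $G_0=K_c(z_0)$, where $c>0$ and $z_0\in\mathbb{R}^n$, and with phase restrictions $\Gamma_t$, $t\in[t_0,T]$. Then the maximal radius $c^*$ of the ball $K_c(z_0)$ such that the trivial solution of the linear system is $\{K_{c^*}(z_0),\Gamma_t,t_0,T\}$-stable is $$c^*=\min_{t\in[t_0,T]}\ \min_{s=1,2,\dots,N}\ \frac{1-\left|l_s^T(t)X(t,t_0)z_0\right|}{\sqrt{l_s^T(t)H(t)l_s(t)}},$$ where the matrix $H(t)=X(t,t_0)X^T(t,t_0)$ satisfies the Lyapunov matrix differential equation $\frac{dH(t)}{dt}=A(t)H(t)+H(t)A^T(t)$, $t\in[t_0,T]$, with initial condition $H(t_0)=I$, the identity matrix of order $n$.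
   Context: $A(t)$ is an $n\times n$ matrix with components continuous on $[t_0,T]$, and $X(t,t_0)$ is the fundamental matrix of solutions of $\frac{dx}{dt}=A(t)x$ normalized with respect to $t_0$, i.e. $X(t_0,t_0)=I$. Denote by $x(t,x_0,t_0)=X(t,t_0)x_0$ the solution with $x(t_0)=x_0$. For $s=1,2,\dots,N$, $l_s(t)$ is a continuous $n$-dimensional vector function on $[t_0,T]$, and $$\Gamma_t=\{x\in\mathbb{R}^n: |l_s^T(t)x|\le 1,\ s=1,2,\dots,N\},\quad t\in[t_0,T].$$ $K_c(z_0)=\{x\in\mathbb{R}^n:\|x-z_0\|\le c\}$ is the closed Euclidean ball. Definition. The trivial solution $x(t)\equiv 0$ is said to be $\{G_0,\Gamma_t,t_0,T\}$-stable if $x(t,x_0,t_0)\in\Gamma_t$ for all $t\in[t_0,T]$ as soon as $x_0\in G_0$. Standing assumptions on the sets in this definition: the phase restriction sets $\Gamma_t\subset\mathbb{R}^n$ are compact with $0\in\Gamma_t$ for $t\in[t_0,T]$, and the set of initial conditions satisfies $G_0\subseteq\Gamma_{t_0}$ and $0\in G_0$. *)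

theory Defs
  imports "HOL-Analysis.Analysis"
begin

definition fundamental_matrix ::
  "(real \<Rightarrow> real^'n^'n) \<Rightarrow> real \<Rightarrow> real \<Rightarrow> (real \<Rightarrow> real^'n^'n) \<Rightarrow> bool" where
  "fundamental_matrix A t0 T X \<longleftrightarrow>
     X t0 = mat 1 \<and>
     (\<forall>t\<in>{t0..T}. (X has_vector_derivative (A t ** X t)) (at t within {t0..T}))"

definition phase_set :: "nat \<Rightarrow> (nat \<Rightarrow> real \<Rightarrow> real^'n) \<Rightarrow> real \<Rightarrow> (real^'n) set" where
  "phase_set N l t = {x. \<forall>s\<in>{1..N}. \<bar>l s t \<bullet> x\<bar> \<le> 1}"

text \<open>Stability of the trivial solution, for the solutions \<open>x(t, x0, t0) = X(t) x0\<close>.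
  The standing assumptions on the set of initial conditions are kept apart in
  \<open>initial_set_ok\<close>.\<close>

definition trivial_stable ::
  "(real \<Rightarrow> real^'n^'n) \<Rightarrow> (real^'n) set \<Rightarrow> (real \<Rightarrow> (real^'n) set) \<Rightarrow> real \<Rightarrow> real \<Rightarrow> bool" where
  "trivial_stable X G0 \<Gamma> t0 T \<longleftrightarrow> (\<forall>x0\<in>G0. \<forall>t\<in>{t0..T}. X t *v x0 \<in> \<Gamma> t)"

definition initial_set_ok ::
  "(real^'n) set \<Rightarrow> (real \<Rightarrow> (real^'n) set) \<Rightarrow> real \<Rightarrow> bool" where
  "initial_set_ok G0 \<Gamma> t0 \<longleftrightarrow> G0 \<subseteq> \<Gamma> t0 \<and> 0 \<in> G0"

definition H_mat :: "(real \<Rightarrow> real^'n^'n) \<Rightarrow> real \<Rightarrow> real^'n^'n" where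
  "H_mat X t = X t ** transpose (X t)"

text \<open>If \<open>l s t = 0\<close>, the \<open>s\<close>-th constraint at time \<open>t\<close> is void. The quotient is then
  \<open>1 / 0 = \<infinity>\<close> in \<^typ>\<open>ereal\<close> (not \<open>0\<close>, as it would be in \<^typ>\<open>real\<close>), so that it does not
  affect the minimum.\<close>

definition radius_quotient ::
  "(real \<Rightarrow> real^'n^'n) \<Rightarrow> (nat \<Rightarrow> real \<Rightarrow> real^'n) \<Rightarrow> real^'n \<Rightarrow> real \<Rightarrow> nat \<Rightarrow> ereal" where
  "radius_quotient X l z0 t s =
     ereal (1 - \<bar>l s t \<bullet> (X t *v z0)\<bar>) / ereal (sqrt (l s t \<bullet> (H_mat X t *v l s t)))"

definition is_minimum :: "'a::linorder set \<Rightarrow> 'a \<Rightarrow> bool" where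
  "is_minimum S m \<longleftrightarrow> m \<in> S \<and> (\<forall>x\<in>S. m \<le> x)"

definition is_maximum :: "'a::linorder set \<Rightarrow> 'a \<Rightarrow> bool" where
  "is_maximum S m \<longleftrightarrow> m \<in> S \<and> (\<forall>x\<in>S. x \<le> m)"

end

(*
Put u = X(t)^T l_s(t). Then l_s(t) \<bullet> X(t) x = u \<bullet> x and l_s(t) \<bullet> H(t) l_s(t) = |u|^2, and the
maximum of |u \<bullet> x| over the ball K_c(z0) is |u \<bullet> z0| + c |u|. So stability for K_c(z0) means
c |u| <= 1 - |u \<bullet> z0| for all s and t, that is, c is at most every quotient.
If u = 0 at some time, then the numerator 1 - |u \<bullet> z0| is 1 there and the quotient tends to
infinity nearby. Hence each quotient is continuous in t as an extended real function and attains
its infimum. The minimum is finite because the compact set \<Gamma>_{t0} is not the whole space,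
which forces l_s(t0) \<noteq> 0 for some s.
*)
theory Submission
  imports Defs
begin

section \<open>The Lyapunov equation for \<open>H_mat\<close>\<close>

lemma bounded_bilinear_matrix_matrix_mult:
  "bounded_bilinear ((**) :: real^'n^'m \<Rightarrow> real^'p^'n \<Rightarrow> real^'p^'m)"
proof -
  have "bilinear ((**) :: real^'n^'m \<Rightarrow> real^'p^'n \<Rightarrow> real^'p^'m)"
    by (auto simp: bilinear_def linear_iff matrix_matrix_mult_def vec_eq_iff sum.distrib
        sum_distrib_left algebra_simps)
  then show ?thesis
    by (simp add: bilinear_conv_bounded_bilinear)
qed

lemma bounded_linear_transpose:
  "bounded_linear (transpose :: real^'n^'m \<Rightarrow> real^'m^'n)"
proof -
  have "linear (transpose :: real^'n^'m \<Rightarrow> real^'m^'n)"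
    by (auto simp: linear_iff transpose_def vec_eq_iff)
  then show ?thesis
    by (simp add: linear_conv_bounded_linear)
qed

text \<open>Product rule for X X^T, combined with (A X)^T = X^T A^T. Here \<open>A\<close> is one
  matrix, the value of the coefficient at \<open>t\<close>.\<close>

lemma has_vector_derivative_H_mat:
  assumes X: "(X has_vector_derivative (A ** X t)) (at t within S)"
  shows "(H_mat X has_vector_derivative (A ** H_mat X t + H_mat X t ** transpose A)) (at t within S)"
proof -
  have "((\<lambda>t. transpose (X t)) has_vector_derivative transpose (A ** X t)) (at t within S)"
    using bounded_linear.has_vector_derivative[OF bounded_linear_transpose X] .
  from bounded_bilinear.has_vector_derivative[OF bounded_bilinear_matrix_matrix_mult X this]
  show ?thesis
    by (simp add: H_mat_def[abs_def] matrix_transpose_mul matrix_mul_assoc add.commute)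
qed

section \<open>Norm form of the quotients; linear forms on a ball\<close>

lemma inner_H_mat: "v \<bullet> (H_mat X t *v v) = (norm (v v* X t))\<^sup>2"
  by (metis H_mat_def dot_lmul_matrix matrix_vector_mul_assoc power2_norm_eq_inner
      transpose_matrix_vector)

text \<open>The row-vector product \<open>l s t v* X t\<close> is the vector u = X(t)^T l_s(t), so
  both parts of the quotient depend on u alone.\<close>

lemma radius_quotient_eq:
  "radius_quotient X l z0 t s =
     ereal (1 - \<bar>(l s t v* X t) \<bullet> z0\<bar>) / ereal (norm (l s t v* X t))"
  by (simp add: radius_quotient_def inner_H_mat dot_lmul_matrix)

lemma abs_inner_le_on_cball_iff:
  fixes u z :: "'a::real_inner"
  assumes "0 \<le> c"
  shows "(\<forall>x\<in>cball z c. \<bar>u \<bullet> x\<bar> \<le> k) \<longleftrightarrow> c * norm u \<le> k - \<bar>u \<bullet> z\<bar>"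
proof
  assume *: "\<forall>x\<in>cball z c. \<bar>u \<bullet> x\<bar> \<le> k"
  \<comment> \<open>The form is extremal on the ball at z + y and z - y; the sign of
    \<open>u \<bullet> z\<close> decides which of the two gives |u \<bullet> z| + c |u|. Since
    \<open>sgn 0 = 0\<close>, the case u = 0 is covered.\<close>
  define y where "y = c *\<^sub>R sgn u"
  have "norm y \<le> c"
    using assms by (simp add: y_def norm_sgn)
  then have "\<bar>u \<bullet> (z + y)\<bar> \<le> k" "\<bar>u \<bullet> (z - y)\<bar> \<le> k"
    using * by (auto simp: dist_norm)
  moreover have "u \<bullet> y = c * norm u"
    by (cases "u = 0") (simp_all add: y_def sgn_div_norm dot_square_norm power2_eq_square)
  ultimately show "c * norm u \<le> k - \<bar>u \<bullet> z\<bar>"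
    by (simp add: inner_add_right inner_diff_right)
next
  assume *: "c * norm u \<le> k - \<bar>u \<bullet> z\<bar>"
  show "\<forall>x\<in>cball z c. \<bar>u \<bullet> x\<bar> \<le> k"
  proof
    fix x assume "x \<in> cball z c"
    then have "norm (x - z) \<le> c"
      by (simp add: dist_norm norm_minus_commute)
    then have "\<bar>u \<bullet> (x - z)\<bar> \<le> c * norm u"
      by (metis Cauchy_Schwarz_ineq2 mult.commute mult_left_mono norm_ge_zero order_trans)
    with * show "\<bar>u \<bullet> x\<bar> \<le> k"
      by (simp add: inner_diff_right)
  qed
qed

section \<open>Quotients in the extended reals\<close>

lemma ereal_le_divide_iff:
  assumes "0 \<le> b" "b = 0 \<Longrightarrow> 0 < a"
  shows "ereal c \<le> ereal a / ereal b \<longleftrightarrow> c * b \<le> a"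
  \<comment> \<open>At b = 0 both sides are true: the quotient is \<infinity> and c * 0 < a. With a
    = 0 as well, 0 / 0 = 0 would break the equivalence for c > 0.\<close>
  using assms by (cases "b = 0") (auto simp: divide_ereal_def zero_ereal_def[symmetric] field_simps)

lemma ereal_less_divide_iff:
  assumes "0 \<le> b" "b = 0 \<Longrightarrow> 0 < a"
  shows "ereal c < ereal a / ereal b \<longleftrightarrow> c * b < a"
  using assms by (cases "b = 0") (auto simp: divide_ereal_def zero_ereal_def[symmetric] field_simps)

lemma continuous_on_ereal_divide:
  fixes a b :: "'a::topological_space \<Rightarrow> real"
  assumes a: "continuous_on S a" and b: "continuous_on S b"
    and nonneg: "\<And>t. t \<in> S \<Longrightarrow> 0 \<le> b t"
    and pos: "\<And>t. t \<in> S \<Longrightarrow> b t = 0 \<Longrightarrow> 0 < a t"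
  shows "continuous_on S (\<lambda>t. ereal (a t) / ereal (b t))"
  unfolding continuous_on_def
proof
  fix t assume t: "t \<in> S"
  have la: "(a \<longlongrightarrow> a t) (at t within S)" and lb: "(b \<longlongrightarrow> b t) (at t within S)"
    using a b t by (auto simp: continuous_on_def)
  have inS: "eventually (\<lambda>x. x \<in> S) (at t within S)"
    by (simp add: eventually_at_topological) blast
  show "((\<lambda>t. ereal (a t) / ereal (b t)) \<longlongrightarrow> ereal (a t) / ereal (b t)) (at t within S)"
  proof (cases "b t = 0")
    case True
    have "eventually (\<lambda>x. ereal r < ereal (a x) / ereal (b x)) (at t within S)" for r
    proof -
      \<comment> \<open>The quotient exceeds r where a - r b > 0. This difference tends to a(t) > 0,
        and the criterion also covers nearby zeros of b.\<close>
      have "((\<lambda>x. a x - r * b x) \<longlongrightarrow> a t - r * b t) (at t within S)"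
        by (intro tendsto_intros la lb)
      then have "eventually (\<lambda>x. 0 < a x - r * b x) (at t within S)"
        using pos[OF t True] True by (intro order_tendstoD(1)) auto
      with inS show ?thesis
        by eventually_elim (subst ereal_less_divide_iff, auto simp: nonneg pos)
    qed
    then have "((\<lambda>t. ereal (a t) / ereal (b t)) \<longlongrightarrow> \<infinity>) (at t within S)"
      by (simp add: tendsto_PInfty)
    then show ?thesis
      using pos[OF t True] True by (simp add: divide_ereal_def zero_ereal_def[symmetric])
  next
    case False
    have "((\<lambda>x. ereal (a x / b x)) \<longlongrightarrow> ereal (a t / b t)) (at t within S)"
      using False by (intro tendsto_intros la lb)
    moreover have "eventually (\<lambda>x. ereal (a x / b x) = ereal (a x) / ereal (b x)) (at t within S)"
      using tendsto_imp_eventually_ne[OF lb False] by eventually_elim simp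
    ultimately have "((\<lambda>x. ereal (a x) / ereal (b x)) \<longlongrightarrow> ereal (a t / b t)) (at t within S)"
      by (rule Lim_transform_eventually)
    then show ?thesis
      using False by simp
  qed
qed

text \<open>Each \<open>f _ s\<close> is minimised separately, at \<open>p s\<close>. If
  \<open>s0\<close> gives the least of these finitely many values, then \<open>p s0\<close> also
  minimises the inner \<open>Min\<close>, whose continuity is never invoked.\<close>

lemma Min_image_attains_inf:
  fixes f :: "'a::topological_space \<Rightarrow> 's \<Rightarrow> 'b::linorder_topology"
  assumes "compact K" "K \<noteq> {}" "finite I" "I \<noteq> {}"
    and cont: "\<And>s. s \<in> I \<Longrightarrow> continuous_on K (\<lambda>t. f t s)"
  obtains t where "t \<in> K" "\<And>t'. t' \<in> K \<Longrightarrow> Min (f t ` I) \<le> Min (f t' ` I)"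
proof -
  have "\<exists>t\<in>K. \<forall>t'\<in>K. f t s \<le> f t' s" if "s \<in> I" for s
    using continuous_attains_inf[OF assms(1,2) cont[OF that]] .
  then obtain p where p: "\<And>s. s \<in> I \<Longrightarrow> p s \<in> K"
      "\<And>s t'. s \<in> I \<Longrightarrow> t' \<in> K \<Longrightarrow> f (p s) s \<le> f t' s"
    by metis
  have "Min ((\<lambda>s. f (p s) s) ` I) \<in> (\<lambda>s. f (p s) s) ` I"
    using assms(3,4) by (intro Min_in) auto
  then obtain s0 where s0: "s0 \<in> I" "Min ((\<lambda>s. f (p s) s) ` I) = f (p s0) s0"
    by auto
  have least: "f (p s0) s0 \<le> f (p s) s" if "s \<in> I" for s
    using that assms(3) by (auto simp: s0(2)[symmetric])
  have "Min (f (p s0) ` I) \<le> Min (f t' ` I)" if "t' \<in> K" for t'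
  proof -
    have "f (p s0) s0 \<le> Min (f t' ` I)"
      using assms(3,4) p(2)[OF _ that] least by (auto intro: order_trans)
    moreover have "Min (f (p s0) ` I) \<le> f (p s0) s0"
      using assms(3) s0(1) by simp
    ultimately show ?thesis
      by (rule order_trans[rotated])
  qed
  with p(1)[OF s0(1)] show thesis
    by (rule that)
qed

text \<open>If m \<le> a, the interval is empty and both sides fail, because a < r.\<close>

lemma is_maximum_greaterThanAtMost_iff:
  fixes a m r :: "'a::linorder"
  assumes "a < r"
  shows "is_maximum {a<..m} r \<longleftrightarrow> r = m"
proof
  assume *: "is_maximum {a<..m} r"
  then have "r \<le> m"
    by (simp add: is_maximum_def)
  moreover from this have "m \<le> r"
    using * assms by (simp add: is_maximum_def)
  ultimately show "r = m"
    by simp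
qed (use assms in \<open>simp add: is_maximum_def\<close>)

section \<open>Stable radii and the finite minimum\<close>

lemma trivial_stable_cball_iff:
  assumes "0 < c"
  shows "trivial_stable X (cball z0 c) (phase_set N l) t0 T \<longleftrightarrow>
    (\<forall>t\<in>{t0..T}. \<forall>s\<in>{1..N}. ereal c \<le> radius_quotient X l z0 t s)"
proof -
  \<comment> \<open>A vanishing u makes the numerator 1, so the division lemma applies to every
    constraint, void ones included.\<close>
  have "(\<forall>x\<in>cball z0 c. \<bar>l s t \<bullet> (X t *v x)\<bar> \<le> 1) \<longleftrightarrow> ereal c \<le> radius_quotient X l z0 t s"
    for s t
    using abs_inner_le_on_cball_iff[of c z0 "l s t v* X t" 1] assms
    by (subst radius_quotient_eq, subst ereal_le_divide_iff) (auto simp: dot_lmul_matrix)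
  then show ?thesis
    unfolding trivial_stable_def phase_set_def by blast
qed

lemma compact_phase_set_imp_nonzero:
  fixes l :: "nat \<Rightarrow> real \<Rightarrow> real^'n"
  assumes "compact (phase_set N l t)"
  obtains s where "s \<in> {1..N}" "l s t \<noteq> 0"
proof -
  have "\<not> compact (UNIV :: (real^'n) set)"
    using compact_imp_bounded not_bounded_UNIV by blast
  moreover have "phase_set N l t = UNIV" if "\<forall>s\<in>{1..N}. l s t = 0"
    using that by (simp add: phase_set_def)
  ultimately show thesis
    using assms that by metis
qed

lemma continuous_on_radius_quotient:
  assumes X: "continuous_on S X" and l: "continuous_on S (l s)"
  shows "continuous_on S (\<lambda>t. radius_quotient X l z0 t s)"
proof -
  have "continuous_on S (\<lambda>t. l s t v* X t)"
    unfolding vector_matrix_mult_def by (intro continuous_intros X l)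
  then show ?thesis
    unfolding radius_quotient_eq
    by (intro continuous_on_ereal_divide continuous_intros) auto
qed

lemma minimum_radius_quotient_exists:
  fixes X :: "real \<Rightarrow> real^'n^'n"
  assumes "t0 \<le> T" "X t0 = mat 1" "continuous_on {t0..T} X"
    and "\<forall>s\<in>{1..N}. continuous_on {t0..T} (l s)"
    and "compact (phase_set N l t0)"
  obtains cstar where
    "is_minimum ((\<lambda>t. Min ((\<lambda>s. radius_quotient X l z0 t s) ` {1..N})) ` {t0..T}) (ereal cstar)"
proof -
  let ?q = "radius_quotient X l z0"
  let ?M = "\<lambda>t. Min (?q t ` {1..N})"
  obtain s where s: "s \<in> {1..N}" "l s t0 \<noteq> 0"
    using compact_phase_set_imp_nonzero assms(5) by metis
  obtain t where t: "t \<in> {t0..T}" and least: "\<And>t'. t' \<in> {t0..T} \<Longrightarrow> ?M t \<le> ?M t'"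
  proof (rule Min_image_attains_inf[of "{t0..T}" "{1..N}" ?q])
    show "continuous_on {t0..T} (\<lambda>t. ?q t s)" if "s \<in> {1..N}" for s
      using assms(3,4) that by (blast intro: continuous_on_radius_quotient)
  qed (use assms(1) s(1) in auto)
  have "?M t \<le> ?M t0"
    using assms(1) by (intro least) simp
  also have "\<dots> \<le> ?q t0 s"
    using s(1) by simp
  \<comment> \<open>As X(t0) = I, here u = \<open>l s t0\<close>, which is nonzero, and the quotient
    is a real number.\<close>
  also have "\<dots> < \<infinity>"
    using s(2) assms(2) by (simp add: radius_quotient_eq)
  finally have "?M t \<noteq> \<infinity>"
    by simp
  moreover have "?M t \<noteq> -\<infinity>"
  proof -
    have "?M t \<in> ?q t ` {1..N}"
      using s(1) by (intro Min_in) auto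
    \<comment> \<open>Only a negative numerator over 0 could give -\<infinity>, but the numerator is
      1 when u = 0.\<close>
    moreover have "?q t s' \<noteq> -\<infinity>" for s'
      by (cases "l s' t v* X t = 0")
        (auto simp: radius_quotient_eq divide_ereal_def zero_ereal_def[symmetric])
    ultimately show ?thesis
      by (metis imageE)
  qed
  ultimately obtain m where "?M t = ereal m"
    by (cases "?M t") auto
  then have "ereal m \<in> ?M ` {t0..T}"
    using t by (metis imageI)
  with least \<open>?M t = ereal m\<close> show thesis
    by (intro that[of m]) (auto simp: is_minimum_def)
qed

text \<open>Radii r > 0 are compared with \<open>cstar\<close> because \<open>cstar\<close> may be
  nonpositive; then no ball of positive radius is stable and there is no maximum. Likewise, for
  \<open>cstar\<close> < |z0| no stable ball contains 0, so the last equivalence is restricted to r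
  satisfying \<open>initial_set_ok\<close>.\<close>

theorem mainTheorem3:
  fixes A X :: "real \<Rightarrow> real^'n^'n"
    and l :: "nat \<Rightarrow> real \<Rightarrow> real^'n"
    and z0 :: "real^'n"
    and t0 T :: real
    and N :: nat
  assumes "t0 < T"
    and "1 \<le> N"
    and "\<forall>i j. continuous_on {t0..T} (\<lambda>t. A t $ i $ j)"
    and "fundamental_matrix A t0 T X"
    and "\<forall>s\<in>{1..N}. continuous_on {t0..T} (l s)"
    and "\<forall>t\<in>{t0..T}. compact (phase_set N l t) \<and> 0 \<in> phase_set N l t"
  shows "H_mat X t0 = mat 1 \<and>
    (\<forall>t\<in>{t0..T}. (H_mat X has_vector_derivative
        (A t ** H_mat X t + H_mat X t ** transpose (A t))) (at t within {t0..T})) \<and>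
    (\<exists>cstar::real.
       is_minimum ((\<lambda>t. Min ((\<lambda>s. radius_quotient X l z0 t s) ` {1..N})) ` {t0..T})
         (ereal cstar) \<and>
       (\<forall>r>0. is_maximum {c. 0 < c \<and> trivial_stable X (cball z0 c) (phase_set N l) t0 T} r
                \<longleftrightarrow> r = cstar) \<and>
       (\<forall>r>0. initial_set_ok (cball z0 r) (phase_set N l) t0 \<longrightarrow>
          (is_maximum {c. 0 < c \<and> initial_set_ok (cball z0 c) (phase_set N l) t0 \<and>
                          trivial_stable X (cball z0 c) (phase_set N l) t0 T} r
             \<longleftrightarrow> r = cstar)))"
proof (intro conjI ballI)
  show "H_mat X t0 = mat 1"
    using assms(4) by (simp add: H_mat_def fundamental_matrix_def)
next
  fix t assume "t \<in> {t0..T}"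
  then show "(H_mat X has_vector_derivative
        (A t ** H_mat X t + H_mat X t ** transpose (A t))) (at t within {t0..T})"
    using assms(4) by (intro has_vector_derivative_H_mat) (simp add: fundamental_matrix_def)
next
  let ?q = "radius_quotient X l z0"
  let ?stable = "\<lambda>c. trivial_stable X (cball z0 c) (phase_set N l) t0 T"
  let ?ok = "\<lambda>c. initial_set_ok (cball z0 c) (phase_set N l) t0"
  have X0: "X t0 = mat 1"
    and dX: "\<And>t. t \<in> {t0..T} \<Longrightarrow> (X has_vector_derivative (A t ** X t)) (at t within {t0..T})"
    using assms(4) unfolding fundamental_matrix_def by blast+
  have contX: "continuous_on {t0..T} X"
    unfolding continuous_on_eq_continuous_within
    using dX has_vector_derivative_continuous by blast
  obtain cstar where cstar:
    "is_minimum ((\<lambda>t. Min (?q t ` {1..N})) ` {t0..T}) (ereal cstar)"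
    using minimum_radius_quotient_exists[of t0 T X N l z0] assms(1,5,6) X0 contX by auto
  have stable_iff: "?stable c \<longleftrightarrow> c \<le> cstar" if "0 < c" for c
  proof -
    have "?stable c \<longleftrightarrow> (\<forall>t\<in>{t0..T}. ereal c \<le> Min (?q t ` {1..N}))"
      using assms(2) by (simp add: trivial_stable_cball_iff[OF that])
    also have "\<dots> \<longleftrightarrow> ereal c \<le> ereal cstar"
    proof
      assume "\<forall>t\<in>{t0..T}. ereal c \<le> Min (?q t ` {1..N})"
      then show "ereal c \<le> ereal cstar"
        using cstar unfolding is_minimum_def by (metis (no_types, lifting) imageE)
    next
      assume "ereal c \<le> ereal cstar"
      then show "\<forall>t\<in>{t0..T}. ereal c \<le> Min (?q t ` {1..N})"
        using cstar unfolding is_minimum_def by (metis (no_types, lifting) imageI order_trans)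
    qed
    finally show ?thesis
      by simp
  qed
  \<comment> \<open>Inclusion in the phase set at t0 is stability read at time t0, and a larger
    concentric ball still contains 0.\<close>
  have ok_mono: "?ok c" if "?ok r" "r \<le> c" "?stable c" for r c
  proof -
    have "cball z0 c \<subseteq> phase_set N l t0"
    proof
      fix x assume "x \<in> cball z0 c"
      then have "X t0 *v x \<in> phase_set N l t0"
        using that(3) assms(1) by (simp add: trivial_stable_def)
      then show "x \<in> phase_set N l t0"
        by (simp add: X0)
    qed
    with that(1,2) show ?thesis
      by (auto simp: initial_set_ok_def)
  qed
  show "\<exists>cstar::real.
       is_minimum ((\<lambda>t. Min ((\<lambda>s. radius_quotient X l z0 t s) ` {1..N})) ` {t0..T})
         (ereal cstar) \<and>
       (\<forall>r>0. is_maximum {c. 0 < c \<and> trivial_stable X (cball z0 c) (phase_set N l) t0 T} r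
                \<longleftrightarrow> r = cstar) \<and>
       (\<forall>r>0. initial_set_ok (cball z0 r) (phase_set N l) t0 \<longrightarrow>
          (is_maximum {c. 0 < c \<and> initial_set_ok (cball z0 c) (phase_set N l) t0 \<and>
                          trivial_stable X (cball z0 c) (phase_set N l) t0 T} r
             \<longleftrightarrow> r = cstar))"
  proof (intro exI[of _ cstar] conjI allI impI)
    fix r :: real assume "0 < r"
    have "{c. 0 < c \<and> ?stable c} = {0<..cstar}"
      using stable_iff by auto
    then show "is_maximum {c. 0 < c \<and> ?stable c} r \<longleftrightarrow> r = cstar"
      using is_maximum_greaterThanAtMost_iff[OF \<open>0 < r\<close>] by (simp only:)
  next
    fix r :: real assume r: "0 < r" "?ok r"
    show "is_maximum {c. 0 < c \<and> ?ok c \<and> ?stable c} r \<longleftrightarrow> r = cstar"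
    proof
      assume max: "is_maximum {c. 0 < c \<and> ?ok c \<and> ?stable c} r"
      then have "r \<le> cstar"
        using stable_iff[OF r(1)] by (simp add: is_maximum_def)
      moreover have "cstar \<le> r"
      proof -
        \<comment> \<open>By \<open>ok_mono\<close>, \<open>cstar\<close> itself is an admissible
          radius, so maximality of r bounds it.\<close>
        have "0 < cstar" "?stable cstar"
          using r(1) \<open>r \<le> cstar\<close> stable_iff[of cstar] by auto
        with max ok_mono[OF r(2) \<open>r \<le> cstar\<close>] show ?thesis
          by (simp add: is_maximum_def)
      qed
      ultimately show "r = cstar"
        by simp
    next
      assume "r = cstar"
      with r show "is_maximum {c. 0 < c \<and> ?ok c \<and> ?stable c} r"
        using stable_iff by (auto simp: is_maximum_def)
    qed
  qed (fact cstar)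
qed

end
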